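(* Let $p$ be a prime with $p\equiv 5$ or $7\pmod 8$, and let $l$ be an integer with $0\leq l\leq p-1$ and $p\mid 8l+3$. Then for all integers $n\geq 0$, \[a_{p-4}(pn+l)\equiv 0\pmod{p}.\]
   Context: For a positive integer $m$ and complex $q$ with $|q|<1$, write $f_m=\prod_{k\geq 1}(1-q^{mk})$. For an integer $c\geq 1$, a generalized cubic partition of $n$ is a partition of $n$ whose even parts may each appear in $c$ different colors; $a_c(n)$ denotes the number of such partitions of $n$, with $a_c(0)=1$. Equivalently, $a_c(n)$ is defined by the generating function $\sum_{n\geq 0}a_c(n)q^n=\dfrac{1}{f_1f_2^{\,c-1}}$. *)

theory Defs
  imports Main "HOL-Library.Multiset" "HOL-Computational_Algebra.Primes"
begin

text \<open>A generalized cubic partition of n: a finite multiset of coloured parts (k, i),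
  where every part k is positive, odd parts carry the single colour 0, and even
  parts carry one of the c colours 0, ..., c-1; the parts sum to n.\<close>

definition gen_cubic_partitions :: "nat \<Rightarrow> nat \<Rightarrow> (nat \<times> nat) multiset set" where
  "gen_cubic_partitions c n =
     {M. (\<forall>x \<in># M. 0 < fst x \<and> (odd (fst x) \<longrightarrow> snd x = 0) \<and> (even (fst x) \<longrightarrow> snd x < c))
         \<and> sum_mset (image_mset fst M) = n}"

definition a :: "nat \<Rightarrow> nat \<Rightarrow> nat" where
  "a c n = card (gen_cubic_partitions c n)"

end

theory Submission
  imports Defs "HOL-Computational_Algebra.Formal_Power_Series"
    "HOL-Computational_Algebra.Polynomial" "HOL-Number_Theory.Cong"
begin

text \<open>
  With c = p - 4 the generating function A satisfies A f_2^p = f_2^5 / f_1 = f_2^3 (f_2^2 / f_1).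
  By Jacobi f_2^3 is the sum of (-1)^j (2 j + 1) q^(j (j + 1)), and by Gauss f_2^2 / f_1 is the sum
  of q^(k (k + 1) / 2). An exponent i = j (j + 1) + k (k + 1) / 2 satisfies
  8 i + 3 = 2 (2 j + 1)^2 + (2 k + 1)^2; if p divides this number, then p divides 2 j + 1 because -2
  is a quadratic non-residue mod p. Hence the coefficients of A f_2^p at all i \<equiv> l vanish mod p, and
  f_2^p \<equiv> f_(2p) is a power series in q^p with constant term 1, so the same holds for A.
  Infinite products are replaced by finite ones, and power series identities by
  equality of \<^const>\<open>fps_cutoff\<close>; both theta identities come from a finite form of the
  triple product identity.
\<close>

unbundle fps_syntax

section \<open>The form 2 x^2 + y^2 modulo p\<close>

text \<open>The classes 1 and 3 form a subgroup of the units modulo 8. It contains both 3 and m,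
  hence also the quotient d.\<close>

lemma mult_mod_8_eq_3:
  fixes d m :: nat
  assumes "(d * m) mod 8 = 3" "m mod 8 = 1 \<or> m mod 8 = 3"
  shows "d mod 8 = 1 \<or> d mod 8 = 3"
proof -
  have "d mod 8 < 8" by simp
  then have "d mod 8 \<in> {0, 1, 2, 3, 4, 5, 6, 7}" unfolding insert_iff by linarith
  moreover have "(d mod 8 * (m mod 8)) mod 8 = 3" using assms(1) by (simp only: mod_mult_eq)
  ultimately show ?thesis using assms(2) by auto
qed

text \<open>Descent: x can be replaced by an odd y < d, and then the cofactor m of y^2 + 2 = d m is
  smaller than d, while d m \<equiv> 3 (mod 8).\<close>

lemma odd_dvd_square_plus_two:
  fixes d x :: nat
  assumes "odd d" "d dvd x\<^sup>2 + 2"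
  shows "d mod 8 = 1 \<or> d mod 8 = 3"
  using assms
proof (induction d arbitrary: x rule: less_induct)
  case (less d)
  show ?case
  proof (cases "d = 1")
    case False
    with less.prems have d: "d > 1" by (cases d) auto
    obtain y where y: "odd y" "y < d" "d dvd y\<^sup>2 + 2"
    proof (cases "odd (x mod d)")
      case True
      have "((x mod d)\<^sup>2 + 2) mod d = (x\<^sup>2 + 2) mod d"
        by (metis mod_add_left_eq power_mod)
      with less.prems(2) have "d dvd (x mod d)\<^sup>2 + 2" by (simp add: dvd_eq_mod_eq_0)
      with True d show ?thesis using that by simp
    next
      \<comment> \<open>An even residue r is replaced by d - r, which is odd because d is odd and
        has the same square modulo d.\<close>
      case False
      define r where "r = x mod d"
      have "(r\<^sup>2 + 2) mod d = (x\<^sup>2 + 2) mod d"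
        unfolding r_def by (metis mod_add_left_eq power_mod)
      with less.prems(2) have r: "d dvd r\<^sup>2 + 2" by (simp add: dvd_eq_mod_eq_0)
      have "r < d" using d by (simp add: r_def)
      then obtain s where s: "d = r + s" "s > 0" using less_imp_add_positive by blast
      have "r > 0"
      proof (rule ccontr)
        assume "\<not> r > 0"
        then have "d dvd 2" using r by (simp add: numeral_2_eq_2)
        with d less.prems(1) show False
          by (auto dest!: dvd_imp_le simp: le_Suc_eq numeral_2_eq_2)
      qed
      have "s\<^sup>2 + 2 + 2 * r * d = d\<^sup>2 + (r\<^sup>2 + 2)"
        by (simp add: s power2_eq_square algebra_simps)
      moreover have "d dvd d\<^sup>2 + (r\<^sup>2 + 2)" by (rule dvd_add[OF _ r]) simp
      ultimately have "d dvd s\<^sup>2 + 2" by (metis dvd_add_left_iff dvd_triv_right)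
      moreover have "odd s" using s False less.prems(1) by (auto simp: r_def)
      ultimately show ?thesis using that[of s] \<open>r > 0\<close> s by simp
    qed
    then obtain m where m: "y\<^sup>2 + 2 = d * m" by (elim dvdE)
    have y8: "y\<^sup>2 mod 8 = 1"
    proof -
      from y(1) obtain k where k: "y = 2 * k + 1" by (elim oddE)
      have "even (k * (k + 1))" by simp
      then obtain t where "k * (k + 1) = 2 * t" by blast
      then have "y\<^sup>2 = 8 * t + 1" by (simp add: k power2_eq_square algebra_simps)
      then show ?thesis by simp
    qed
    have prod8: "(d * m) mod 8 = 3" using y8 unfolding m[symmetric] by presburger
    have "odd (y\<^sup>2 + 2)" using y(1) by simp
    then have "odd m" unfolding m by simp
    \<comment> \<open>This is what makes the descent terminate: it forces the cofactor m below d.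
      Two squares of distinct positive numbers differ by at least 3.\<close>
    have "y\<^sup>2 + 2 < d\<^sup>2"
    proof -
      obtain e where e: "d = y + e" "e > 0" using y(2) less_imp_add_positive by blast
      have "y \<ge> 1" using y(1) by (cases y) auto
      then have "y * e \<ge> 1" "e * e \<ge> 1" using e by simp_all
      then have "2 * (y * e) + e * e \<ge> 3" by linarith
      then show ?thesis unfolding e by (simp add: power2_eq_square algebra_simps)
    qed
    then have "d * m < d * d" unfolding m by (simp only: power2_eq_square)
    then have "m < d" by simp
    moreover have "m dvd y\<^sup>2 + 2" by (simp only: m dvd_triv_right)
    ultimately have "m mod 8 = 1 \<or> m mod 8 = 3" using less.IH \<open>odd m\<close> by blast
    with prod8 show ?thesis by (rule mult_mod_8_eq_3)
  qed simp
qed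

text \<open>If x had an inverse u modulo p, multiplying by u^2 would make (y u)^2 + 2 divisible by
  p, which restricts p to 1 or 3 modulo 8.\<close>

lemma prime_dvd_sum_square_twice_square:
  fixes p x y :: nat
  assumes p: "prime p" "p mod 8 = 5 \<or> p mod 8 = 7" and dvd: "p dvd 2 * x\<^sup>2 + y\<^sup>2"
  shows "p dvd x"
proof (rule ccontr)
  assume "\<not> p dvd x"
  then have "coprime x p" using p(1) by (simp add: coprime_commute prime_imp_coprime)
  then obtain u where u: "[x * u = 1] (mod p)" using cong_solve_coprime_nat by auto
  have "(y * u)\<^sup>2 + 2 * (x * u)\<^sup>2 = u\<^sup>2 * (2 * x\<^sup>2 + y\<^sup>2)"
    by (simp add: power_mult_distrib algebra_simps)
  with dvd have "[(y * u)\<^sup>2 + 2 * (x * u)\<^sup>2 = 0] (mod p)" by (simp add: cong_0_iff)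
  moreover have "[(y * u)\<^sup>2 + 2 * (x * u)\<^sup>2 = (y * u)\<^sup>2 + 2 * 1\<^sup>2] (mod p)"
    by (intro cong_add cong_mult cong_pow u cong_refl)
  ultimately have "p dvd (y * u)\<^sup>2 + 2"
    by (metis cong_0_iff cong_sym cong_trans power_one mult_1_right)
  moreover have "odd p" using p(2) by presburger
  ultimately show False using odd_dvd_square_plus_two p(2) by fastforce
qed


section \<open>The finite triple product identity\<close>

text \<open>Gaussian binomial coefficients, given by a Pascal rule instead of a quotient so that
  they exist in every commutative ring. For k > n the truncated exponent n - k is harmless, since
  its cofactor vanishes.\<close>

fun qbinom :: "'a::comm_ring_1 \<Rightarrow> nat \<Rightarrow> nat \<Rightarrow> 'a" where
  "qbinom q n 0 = 1"
| "qbinom q 0 (Suc k) = 0"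
| "qbinom q (Suc n) (Suc k) = qbinom q n (Suc k) + q ^ (n - k) * qbinom q n k"

lemma qbinom_eq_0 [simp]: "n < k \<Longrightarrow> qbinom q n k = 0"
proof (induction n arbitrary: k)
  case 0
  then show ?case by (cases k) auto
next
  case (Suc n)
  then show ?case by (cases k) auto
qed

text \<open>The q-Pochhammer symbol (q; q)_n; at q = X^m it is the partial product of f_m.\<close>

definition qpoch :: "'a::comm_ring_1 \<Rightarrow> nat \<Rightarrow> 'a" where
  "qpoch q n = (\<Prod>i<n. 1 - q ^ Suc i)"

lemma qpoch_0 [simp]: "qpoch q 0 = 1"
  and qpoch_Suc: "qpoch q (Suc n) = qpoch q n * (1 - q ^ Suc n)"
  by (simp_all add: qpoch_def)

text \<open>The quotient formula with denominators cleared. The Pascal rule reduces it to (1 -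
  q^(n-j)) + q^(n-j) (1 - q^(j+1)) = 1 - q^(n+1).\<close>

lemma qbinom_qpoch: "k \<le> n \<Longrightarrow> qbinom q n k * (qpoch q k * qpoch q (n - k)) = qpoch q n"
proof (induction n arbitrary: k)
  case (Suc n)
  show ?case
  proof (cases k)
    case (Suc j)
    with Suc.prems have j: "j \<le> n" by simp
    have 1: "qbinom q n (Suc j) * (qpoch q (Suc j) * qpoch q (n - j)) = qpoch q n * (1 - q ^ (n - j))"
    \<comment> \<open>For j = n both sides are 0: the binomial vanishes on the left, and 1 - q^0 on
      the right.\<close>
    proof (cases "j = n")
      case False
      then obtain i where i: "n - j = Suc i" "n - Suc j = i" using j by (cases "n - j") auto
      have "qbinom q n (Suc j) * (qpoch q (Suc j) * qpoch q (n - j)) =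
          qbinom q n (Suc j) * (qpoch q (Suc j) * qpoch q (n - Suc j)) * (1 - q ^ (n - j))"
        by (simp add: i qpoch_Suc[of q i] mult_ac)
      then show ?thesis using Suc.IH[of "Suc j"] False j by simp
    qed simp
    have 2: "qbinom q n j * (qpoch q (Suc j) * qpoch q (n - j)) = qpoch q n * (1 - q ^ Suc j)"
    proof -
      have "qbinom q n j * (qpoch q (Suc j) * qpoch q (n - j)) =
          qbinom q n j * (qpoch q j * qpoch q (n - j)) * (1 - q ^ Suc j)"
        by (simp add: qpoch_Suc mult_ac)
      then show ?thesis using Suc.IH[OF j] by simp
    qed
    have "qbinom q (Suc n) k * (qpoch q k * qpoch q (Suc n - k)) =
       qbinom q n (Suc j) * (qpoch q (Suc j) * qpoch q (n - j)) +
       q ^ (n - j) * (qbinom q n j * (qpoch q (Suc j) * qpoch q (n - j)))"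
      by (simp add: Suc algebra_simps)
    also have "\<dots> = qpoch q n * (1 - q ^ (n - j) * q ^ Suc j)"
      unfolding 1 2 by (simp add: algebra_simps)
    also have "q ^ (n - j) * q ^ Suc j = q ^ Suc n"
      using j by (simp only: power_add[symmetric]) simp
    finally show ?thesis by (simp only: qpoch_Suc)
  qed simp
qed simp

text \<open>The second variable y makes the identity homogeneous, so that z can later be scaled by
  q^(-n) without negative powers.\<close>

lemma q_binomial_theorem:
  "(\<Prod>i<n. y + z * q ^ i) = (\<Sum>k\<le>n. qbinom q n k * q ^ (k choose 2) * z ^ k * y ^ (n - k))"
proof (induction n)
  case (Suc n)
  let ?t = "\<lambda>n k. qbinom q n k * q ^ (k choose 2) * z ^ k * y ^ (n - k)"
  have *: "?t (Suc n) (Suc k) = y * ?t n (Suc k) + z * q ^ n * ?t n k" if "k \<le> n" for k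
  proof -
    have "q ^ (Suc k choose 2) = q ^ k * q ^ (k choose 2)"
      by (simp add: numeral_2_eq_2 power_add)
    moreover have "q ^ n = q ^ (n - k) * q ^ k" using that by (simp flip: power_add)
    \<comment> \<open>At k = n the truncated exponent n - Suc k is off by one, but there the
      coefficient is 0.\<close>
    moreover have "qbinom q n (Suc k) = 0 \<or> y ^ (n - k) = y * y ^ (n - Suc k)"
      using that by (cases "k = n") (auto simp: Suc_diff_Suc simp flip: power_Suc)
    ultimately show ?thesis by (auto simp: algebra_simps)
  qed
  have "(\<Prod>i<Suc n. y + z * q ^ i) = (\<Sum>k\<le>n. ?t n k) * (y + z * q ^ n)"
    by (simp only: prod.lessThan_Suc Suc.IH)
  also have "\<dots> = y * (\<Sum>k\<le>n. ?t n k) + (\<Sum>k\<le>n. z * q ^ n * ?t n k)"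
    by (simp only: sum_distrib_left[symmetric] distrib_left distrib_right mult.commute)
  also have "(\<Sum>k\<le>n. ?t n k) = (\<Sum>k\<le>Suc n. ?t n k)" by simp
  also have "\<dots> = ?t n 0 + (\<Sum>k\<le>n. ?t n (Suc k))" by (rule sum.atMost_Suc_shift)
  also have "y * \<dots> + (\<Sum>k\<le>n. z * q ^ n * ?t n k) =
      ?t (Suc n) 0 + (\<Sum>k\<le>n. y * ?t n (Suc k) + z * q ^ n * ?t n k)"
    by (simp add: distrib_left sum_distrib_left sum.distrib)
  also have "(\<Sum>k\<le>n. y * ?t n (Suc k) + z * q ^ n * ?t n k) = (\<Sum>k\<le>n. ?t (Suc n) (Suc k))"
    by (rule sum.cong) (use * in auto)
  finally show ?case by (simp only: sum.atMost_Suc_shift)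
qed (simp add: numeral_2_eq_2)

text \<open>The exponent m (m - 1) / 2 of the triple product, where m = k - n may be negative.\<close>

definition triangle_exp :: "nat \<Rightarrow> nat \<Rightarrow> nat" where
  "triangle_exp n k = (if k \<le> n then Suc (n - k) choose 2 else k - n choose 2)"

lemma triangle_exp_simps [simp]:
  "j \<le> n \<Longrightarrow> triangle_exp n (n - j) = Suc j choose 2"
  "triangle_exp n (n + j) = j choose 2"
  by (auto simp: triangle_exp_def numeral_2_eq_2)

lemma choose_two_add: "(m + n choose 2) = (m choose 2) + (n choose 2) + m * n"
  by (induction m) (simp_all add: numeral_2_eq_2)

text \<open>The left side is the exponent of q in term k of the q-binomial theorem with 2 n factors
  and y = q^n; the right side splits off a part independent of k.\<close>

lemma choose_two_shift:
  assumes "k \<le> 2 * n"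
  shows "(k choose 2) + n * (2 * n - k) = (n choose 2) + n * n + triangle_exp n k"
proof (cases "k \<le> n")
  case True
  then obtain j where n: "n = k + j" using le_Suc_ex by blast
  have "triangle_exp n k = Suc j choose 2" using triangle_exp_simps(1)[of j n] n by simp
  moreover have "2 * (Suc j choose 2) = Suc j * j" "2 * (j choose 2) + j = j * j"
    by (induction j) (auto simp: numeral_2_eq_2 algebra_simps)
  moreover have "(Suc j choose 2) = j + (j choose 2)" by (simp add: numeral_2_eq_2)
  ultimately show ?thesis unfolding n choose_two_add by (simp add: algebra_simps)
next
  case False
  then obtain j where k: "k = n + j" using le_Suc_ex nle_le by blast
  with assms obtain i where "n = j + i" using le_Suc_ex[of j n] by auto
  moreover have "triangle_exp n k = j choose 2" by (simp add: k)
  ultimately show ?thesis by (simp add: k choose_two_add algebra_simps)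
qed

text \<open>The q-binomial theorem for 2 n factors with y = q^n, divided by a power of q.\<close>

lemma finite_triple_product:
  fixes q z :: "'a::idom"
  assumes "q \<noteq> 0"
  shows "(\<Prod>i<n. q ^ Suc i + z) * (\<Prod>i<n. 1 + z * q ^ i) =
    (\<Sum>k\<le>2 * n. qbinom q (2 * n) k * q ^ triangle_exp n k * z ^ k)"
proof -
  \<comment> \<open>Pulling q^i out of factor i < n gives q^(n choose 2), and pulling q^n out of
    each of the other n factors gives q^(n * n).\<close>
  define c where "c = q ^ ((n choose 2) + n * n)"
  have "c * (\<Sum>k\<le>2 * n. qbinom q (2 * n) k * q ^ triangle_exp n k * z ^ k) =
     (\<Sum>k\<le>2 * n. qbinom q (2 * n) k * q ^ (k choose 2) * z ^ k * (q ^ n) ^ (2 * n - k))"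
    unfolding sum_distrib_left
  proof (rule sum.cong[OF refl])
    fix k assume "k \<in> {..2 * n}"
    then have "c * q ^ triangle_exp n k = q ^ (k choose 2) * (q ^ n) ^ (2 * n - k)"
      unfolding c_def power_mult[symmetric] power_add[symmetric] by (simp add: choose_two_shift)
    then show "c * (qbinom q (2 * n) k * q ^ triangle_exp n k * z ^ k) =
      qbinom q (2 * n) k * q ^ (k choose 2) * z ^ k * (q ^ n) ^ (2 * n - k)"
      by (simp add: mult_ac)
  qed
  also have "\<dots> = (\<Prod>i<2 * n. q ^ n + z * q ^ i)" by (rule q_binomial_theorem[symmetric])
  also have "\<dots> = (\<Prod>i<n. q ^ n + z * q ^ i) * (\<Prod>i<n. q ^ n + z * q ^ (n + i))"
  proof -
    have "(\<Prod>i<n + m. q ^ n + z * q ^ i) =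
      (\<Prod>i<n. q ^ n + z * q ^ i) * (\<Prod>i<m. q ^ n + z * q ^ (n + i))" for m
      by (induction m) (simp_all add: mult.assoc)
    then show ?thesis by (simp add: mult_2)
  qed
  also have "(\<Prod>i<n. q ^ n + z * q ^ i) = (\<Prod>i<n. q ^ i) * (\<Prod>i<n. q ^ (n - i) + z)"
    by (simp add: prod.distrib[symmetric] distrib_left mult.commute power_add[symmetric])
  also have "(\<Prod>i<n. q ^ (n - i) + z) = (\<Prod>i<n. q ^ Suc i + z)"
    by (subst prod.nat_diff_reindex[symmetric]) (auto intro!: prod.cong simp: Suc_diff_Suc)
  also have "(\<Prod>i<n. q ^ n + z * q ^ (n + i)) = q ^ (n * n) * (\<Prod>i<n. 1 + z * q ^ i)"
  proof -
    have "q ^ (n * n) = (\<Prod>i<n. q ^ n)" by (simp add: power_mult)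
    then show ?thesis
      by (simp only: prod.distrib[symmetric] distrib_left power_add mult_ac mult_1_right mult_1_left)
  qed
  also have "(\<Prod>i<n. q ^ i) = q ^ (n choose 2)"
    by (induction n) (simp_all add: numeral_2_eq_2 power_add)
  finally have "c * (\<Sum>k\<le>2 * n. qbinom q (2 * n) k * q ^ triangle_exp n k * z ^ k) =
     c * ((\<Prod>i<n. q ^ Suc i + z) * (\<Prod>i<n. 1 + z * q ^ i))"
    by (simp add: c_def power_add mult_ac)
  moreover have "c \<noteq> 0" using assms by (simp add: c_def)
  ultimately show ?thesis by simp
qed

text \<open>Allows the triple product to be read over polynomials with z as the indeterminate, so
  that it can be differentiated in z.\<close>

lemma qbinom_poly: "qbinom [:q:] n k = [:qbinom q n k:]"
  by (induction q n k rule: qbinom.induct)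
    (simp_all add: pCons_one one_pCons poly_const_pow flip: pCons_one)

text \<open>The derivative of the finite triple product at its root z = -1.\<close>

lemma sum_alternating_triple:
  fixes q :: "'a::idom"
  assumes "q \<noteq> 0" "n > 0"
  shows "(\<Sum>k\<le>2 * n. qbinom q (2 * n) k * q ^ triangle_exp n k * ((of_nat n - of_nat k) * (-1) ^ k)) =
     (-1) ^ n * (qpoch q n * qpoch q (n - 1))"
proof -
  define r where "r = (\<lambda>k. qbinom q (2 * n) k * q ^ triangle_exp n k)"
  \<comment> \<open>A is the cofactor of 1 + z, the factor i = 0 of the second product. Hence the
    derivative of the whole product at -1 is A(-1).\<close>
  define A where "A = (\<Prod>i<n. [:q ^ Suc i, 1:]) * (\<Prod>i<n-1. [:1, q ^ Suc i:])"
  obtain m where m: "n = Suc m" using assms(2) by (cases n) auto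
  have "(\<Prod>i<n. [:q:] ^ Suc i + [:0,1:]) * (\<Prod>i<n. 1 + [:0,1:] * [:q:] ^ i) =
    (\<Sum>k\<le>2 * n. qbinom [:q:] (2 * n) k * [:q:] ^ triangle_exp n k * [:0,1:] ^ k)"
    using assms by (intro finite_triple_product) auto
  also have "\<dots> = (\<Sum>k\<le>2 * n. monom (r k) k)"
    by (simp add: r_def qbinom_poly poly_const_pow monom_altdef mult.commute)
  also have "(\<Prod>i<n. [:q:] ^ Suc i + [:0,1:]) = (\<Prod>i<n. [:q ^ Suc i, 1:])"
    by (simp add: poly_const_pow del: power_Suc)
  also have "(\<Prod>i<n. 1 + [:0,1:] * [:q:] ^ i) = [:1,1:] * (\<Prod>i<n-1. [:1, q ^ Suc i:])"
    unfolding m prod.lessThan_Suc_shift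
    by (simp add: poly_const_pow one_pCons del: power_Suc)
  also have "(\<Prod>i<n. [:q ^ Suc i, 1:]) * \<dots> = [:1,1:] * A"
    by (simp only: A_def mult_ac)
  finally have eq: "[:1,1:] * A = (\<Sum>k\<le>2 * n. monom (r k) k)" .
  from arg_cong[OF eq, of "\<lambda>f. poly f (-1)"]
  have 0: "(\<Sum>k\<le>2 * n. r k * (-1) ^ k) = 0"
    by (simp add: poly_sum poly_monom)
  have "poly A (-1) = poly (pderiv ([:1,1:] * A)) (-1)"
    unfolding pderiv_mult by (simp add: pderiv_pCons)
  then have "(\<Sum>k\<le>2 * n. of_nat k * r k * (-1) ^ (k - 1)) = poly A (-1)"
    unfolding eq by (simp add: higher_pderiv_sum[of 1, simplified] pderiv_monom poly_sum poly_monom)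
  also have "poly A (-1) = (\<Prod>i<n. (-1) * (1 - q ^ Suc i)) * qpoch q (n - 1)"
    by (simp add: A_def poly_prod qpoch_def)
  also have "\<dots> = (-1) ^ n * (qpoch q n * qpoch q (n - 1))"
    by (simp only: qpoch_def prod.distrib prod_constant card_lessThan mult.assoc)
  finally have 1: "(\<Sum>k\<le>2 * n. of_nat k * r k * (-1) ^ (k - 1)) = \<dots>" .
  \<comment> \<open>Adding n times the vanishing value at -1 recentres the weight from k to n - k.
    At k = 0 the truncated exponent k - 1 is multiplied by 0.\<close>
  have "(\<Sum>k\<le>2 * n. r k * ((of_nat n - of_nat k) * (-1) ^ k)) =
     of_nat n * (\<Sum>k\<le>2 * n. r k * (-1) ^ k) + (\<Sum>k\<le>2 * n. of_nat k * r k * (-1) ^ (k - 1))"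
    unfolding sum_distrib_left sum.distrib[symmetric]
  proof (rule sum.cong[OF refl])
    fix k show "r k * ((of_nat n - of_nat k) * (-1) ^ k) =
      of_nat n * (r k * (-1) ^ k) + of_nat k * r k * (-1) ^ (k - 1)"
      by (cases k) (simp_all add: algebra_simps)
  qed
  then show ?thesis unfolding 0 1 by (simp add: r_def)
qed

text \<open>Pairs the indices n + 1 + j and n - j, at which \<open>triangle_exp\<close> takes the
  same value; k = 0 remains unpaired.\<close>

lemma sum_reflect_middle:
  fixes f :: "nat \<Rightarrow> 'a::comm_monoid_add"
  shows "(\<Sum>k\<le>2 * n. f k) = (\<Sum>j<n. f (n + Suc j) + f (n - j)) + f 0"
proof -
  have "{..2 * n} = {..n} \<union> {n<..2 * n}" by auto
  then have "(\<Sum>k\<le>2 * n. f k) = (\<Sum>k\<le>n. f k) + (\<Sum>k\<in>{n<..2 * n}. f k)"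
    by (simp add: sum.union_disjoint ivl_disj_int)
  also have "(\<Sum>k\<in>{n<..2 * n}. f k) = (\<Sum>j<n. f (n + Suc j))"
    by (rule sum.reindex_bij_witness[of _ "\<lambda>j. n + Suc j" "\<lambda>k. k - Suc n"]) auto
  also have "(\<Sum>k\<le>n. f k) = (\<Sum>j\<le>n. f (n - j))"
    by (rule sum.reindex_bij_witness[of _ "\<lambda>j. n - j" "\<lambda>j. n - j"]) auto
  also have "\<dots> = (\<Sum>j<n. f (n - j)) + f 0"
    by (simp add: lessThan_Suc_atMost[symmetric])
  finally show ?thesis by (simp add: sum.distrib add_ac)
qed


section \<open>Truncated identities of Jacobi and Gauss\<close>

lemma fps_cutoff_mult_cong:
  "fps_cutoff N A = fps_cutoff N A' \<Longrightarrow> fps_cutoff N B = fps_cutoff N B' \<Longrightarrow>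
    fps_cutoff N (A * B) = fps_cutoff N (A' * B')"
  by (auto simp: fps_cutoff_eq_fps_cutoff_iff fps_mult_nth intro!: sum.cong)

lemma fps_cutoff_sum_cong:
  "(\<And>x. x \<in> S \<Longrightarrow> fps_cutoff N (f x) = fps_cutoff N (g x)) \<Longrightarrow>
    fps_cutoff N (\<Sum>x\<in>S. f x) = fps_cutoff N (\<Sum>x\<in>S. g x)"
  by (auto simp: fps_cutoff_eq_fps_cutoff_iff fps_sum_nth intro!: sum.cong)

text \<open>Over a domain a factor with nonzero constant term preserves subdegrees, so it can be
  cancelled even when it is not a unit, as with the constant 2 over the integers.\<close>

lemma fps_cutoff_mult_left_cancel:
  fixes F :: "'a::idom fps"
  assumes "F $ 0 \<noteq> 0" "fps_cutoff N (F * A) = fps_cutoff N (F * B)"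
  shows "fps_cutoff N A = fps_cutoff N B"
proof -
  have "fps_cutoff N (F * (A - B)) = 0"
    using assms(2) by (simp add: right_diff_distrib fps_cutoff_diff)
  moreover have "subdegree F = 0" "F \<noteq> 0" using assms(1) by auto
  ultimately have "fps_cutoff N (A - B) = 0"
    using assms(1) by (cases "A = B") (auto simp: fps_cutoff_zero_iff subdegree_mult)
  then show ?thesis by (simp add: fps_cutoff_diff)
qed

lemma fps_cutoff_X_power_mult:
  "N \<le> e \<Longrightarrow> fps_cutoff N (fps_X ^ e * A) = 0"
  by (simp add: fps_eq_iff fps_X_power_mult_nth)

lemma fps_cutoff_prod_tail:
  fixes g :: "nat \<Rightarrow> 'a::comm_ring_1 fps"
  assumes "N \<le> m" "\<And>i. N \<le> i \<Longrightarrow> fps_cutoff N (g i) = 0"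
  shows "fps_cutoff N (\<Prod>i<m. 1 + g i) = fps_cutoff N (\<Prod>i<N. 1 + g i)"
  using assms(1)
proof (induction m rule: dec_induct)
  case (step m)
  have "fps_cutoff N (\<Prod>i<Suc m. 1 + g i) = fps_cutoff N ((\<Prod>i<m. 1 + g i) * 1)"
    unfolding prod.lessThan_Suc
    by (rule fps_cutoff_mult_cong) (use step assms(2)[of m] in \<open>auto simp: fps_cutoff_add\<close>)
  then show ?case using step by simp
qed simp

lemma fps_cutoff_prod_X_power:
  fixes c :: "'a::comm_ring_1"
  assumes "d > 0" "N \<le> m"
  shows "fps_cutoff N (\<Prod>i<m. 1 + fps_const c * (fps_X ^ d) ^ Suc i) =
    fps_cutoff N (\<Prod>i<N. 1 + fps_const c * (fps_X ^ d) ^ Suc i)"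
proof (rule fps_cutoff_prod_tail[OF assms(2), where g = "\<lambda>i. fps_const c * (fps_X ^ d) ^ Suc i"])
  fix i assume "N \<le> i"
  moreover have "i \<le> d * i" using assms(1) by simp
  ultimately have "N \<le> d * Suc i" unfolding mult_Suc_right by linarith
  then have "fps_cutoff N (fps_X ^ (d * Suc i) * fps_const c) = 0"
    by (rule fps_cutoff_X_power_mult)
  then show "fps_cutoff N (fps_const c * (fps_X ^ d) ^ Suc i) = 0"
    by (simp only: power_mult[symmetric] mult.commute[of "fps_const c"])
qed

text \<open>The finite substitute for convergence: to precision N, N factors already represent
  f_d.\<close>

lemma fps_cutoff_qpoch:
  assumes "d > 0" "N \<le> m"
  shows "fps_cutoff N (qpoch (fps_X ^ d :: 'a::comm_ring_1 fps) m) = fps_cutoff N (qpoch (fps_X ^ d) N)"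
proof -
  have "fps_const (-1) = (-1 :: 'a fps)" by (metis fps_const_neg fps_const_1_eq_1)
  then show ?thesis
    using fps_cutoff_prod_X_power[OF assms, of "-1 :: 'a"] by (simp add: qpoch_def del: power_Suc)
qed

lemma qpoch_X_power_nth_0: "d > 0 \<Longrightarrow> qpoch (fps_X ^ d) n $ 0 = 1"
  by (induction n) (simp_all add: qpoch_Suc fps_mult_nth_0 power_mult[symmetric] del: power_Suc)

lemma le_choose_two: "j \<le> (Suc j choose 2)"
  by (simp add: numeral_2_eq_2)

text \<open>In the quotient formula the indices n, k and n - k are all at least N, so each product
  may be replaced by \<open>qpoch q N\<close>; two copies stand against one.\<close>

lemma fps_cutoff_qbinom:
  fixes q :: "'a::idom fps"
  assumes q: "q = fps_X ^ d" "d > 0" and "N \<le> k" "k + N \<le> n"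
  shows "fps_cutoff N (qpoch q N * qbinom q n k) = fps_cutoff N 1"
proof (rule fps_cutoff_mult_left_cancel)
  show "qpoch q N $ 0 \<noteq> 0" by (simp add: q qpoch_X_power_nth_0)
  have "fps_cutoff N (qbinom q n k * (qpoch q N * qpoch q N)) =
      fps_cutoff N (qbinom q n k * (qpoch q k * qpoch q (n - k)))"
    unfolding q(1) using assms
    by (intro fps_cutoff_mult_cong fps_cutoff_qpoch[symmetric] refl) auto
  also have "\<dots> = fps_cutoff N (qpoch q n)"
    using assms by (subst qbinom_qpoch) auto
  also have "\<dots> = fps_cutoff N (qpoch q N)"
    unfolding q(1) using assms by (intro fps_cutoff_qpoch) auto
  finally show "fps_cutoff N (qpoch q N * (qpoch q N * qbinom q n k)) = fps_cutoff N (qpoch q N * 1)"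
    by (simp add: mult_ac)
qed

text \<open>The limit of the triple product to precision N, with free weights c so that it serves
  both Jacobi and Gauss. With n = 2 N, the pairs j < N lie far enough from both ends for the
  binomials to be replaced by their limit; all other terms, including k = 0, have exponent at least
  N.\<close>

lemma fps_cutoff_triple_sum:
  fixes q :: "'a::idom fps"
  assumes q: "q = fps_X ^ d" "d > 0" and n: "n = 2 * N"
  shows "fps_cutoff N (qpoch q N * (\<Sum>k\<le>2 * n. qbinom q (2 * n) k * q ^ triangle_exp n k * c k)) =
    fps_cutoff N (\<Sum>j<n. q ^ (Suc j choose 2) * (c (n + Suc j) + c (n - j)))"
proof -
  let ?f = "\<lambda>k. qbinom q (2 * n) k * q ^ triangle_exp n k * c k"
  have small: "fps_cutoff N (q ^ e * A) = 0" if "N \<le> e" for e A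
  proof -
    have "e \<le> d * e" using q(2) by simp
    with that have "N \<le> d * e" by linarith
    then show ?thesis unfolding q(1) power_mult[symmetric] by (rule fps_cutoff_X_power_mult)
  qed
  have "triangle_exp n 0 = (Suc n choose 2)" using triangle_exp_simps(1)[of n n] by simp
  then have "N \<le> triangle_exp n 0" using le_choose_two[of n] n by linarith
  then have last: "fps_cutoff N (qpoch q N * ?f 0) = 0"
    using small[of "triangle_exp n 0" "qpoch q N * c 0"] by (simp add: mult_ac)
  have main: "fps_cutoff N (qpoch q N * (?f (n + Suc j) + ?f (n - j))) =
      fps_cutoff N (q ^ (Suc j choose 2) * (c (n + Suc j) + c (n - j)))" if j: "j < n" for j
  proof -
    let ?b = "\<lambda>k. qpoch q N * qbinom q (2 * n) k"
    have "triangle_exp n (n + Suc j) = (Suc j choose 2)" "triangle_exp n (n - j) = (Suc j choose 2)"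
      using j by (simp_all only: triangle_exp_simps less_imp_le)
    then have eq: "qpoch q N * (?f (n + Suc j) + ?f (n - j)) =
        q ^ (Suc j choose 2) * (?b (n + Suc j) * c (n + Suc j) + ?b (n - j) * c (n - j))"
      by (simp add: algebra_simps)
    show ?thesis
    proof (cases "j < N")
      case True
      then have "fps_cutoff N (?b k) = fps_cutoff N 1" if "k = n + Suc j \<or> k = n - j" for k
        using that n by (intro fps_cutoff_qbinom[OF q]) auto
      then have "fps_cutoff N (?b k * c k) = fps_cutoff N (1 * c k)" if "k = n + Suc j \<or> k = n - j" for k
        using that by (intro fps_cutoff_mult_cong) auto
      then show ?thesis unfolding eq
        by (intro fps_cutoff_mult_cong refl) (simp add: fps_cutoff_add)
    next
      case False
      then have "N \<le> (Suc j choose 2)" using le_choose_two[of j] by linarith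
      then show ?thesis unfolding eq by (simp add: small)
    qed
  qed
  have "fps_cutoff N (qpoch q N * (\<Sum>k\<le>2 * n. ?f k)) =
    fps_cutoff N (\<Sum>j<n. qpoch q N * (?f (n + Suc j) + ?f (n - j)))"
    unfolding sum_reflect_middle[of ?f n] distrib_left[of _ _ "?f 0"] sum_distrib_left
    by (simp only: fps_cutoff_add last add_0_right)
  also have "\<dots> = fps_cutoff N (\<Sum>j<n. q ^ (Suc j choose 2) * (c (n + Suc j) + c (n - j)))"
    using main by (intro fps_cutoff_sum_cong) auto
  finally show ?thesis .
qed

text \<open>Two factors come from the derivative of the triple product at -1, the third from the
  limit of the binomials. As n = 2 N is even, paired weights add up to (-1)^j ((j + 1) + j).\<close>

lemma jacobi_cube_cutoff:
  fixes q :: "int fps"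
  assumes q: "q = fps_X ^ d" "d > 0"
  shows "fps_cutoff N (qpoch q N ^ 3) =
    fps_cutoff N (\<Sum>j<2 * N. q ^ (Suc j choose 2) * of_int ((-1) ^ j * (2 * int j + 1)))"
proof (cases "N = 0")
  case False
  let ?n = "2 * N" and ?c = "\<lambda>k. (of_nat (2 * N) - of_nat k) * (-1) ^ k :: int fps"
  have "q \<noteq> 0" by (simp add: q)
  have "fps_cutoff N (qpoch q N * (qpoch q N * qpoch q N)) =
    fps_cutoff N (qpoch q N * (qpoch q ?n * qpoch q (?n - 1)))"
    unfolding q(1) using q False by (intro fps_cutoff_mult_cong fps_cutoff_qpoch[symmetric] refl) auto
  also have "qpoch q ?n * qpoch q (?n - 1) =
      (\<Sum>k\<le>2 * ?n. qbinom q (2 * ?n) k * q ^ triangle_exp ?n k * ?c k)"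
    using False by (subst sum_alternating_triple[OF \<open>q \<noteq> 0\<close>]) auto
  also have "fps_cutoff N (qpoch q N * \<dots>) =
      fps_cutoff N (\<Sum>j<?n. q ^ (Suc j choose 2) * (?c (?n + Suc j) + ?c (?n - j)))"
    by (rule fps_cutoff_triple_sum[OF q refl])
  also have "(\<Sum>j<?n. q ^ (Suc j choose 2) * (?c (?n + Suc j) + ?c (?n - j))) =
      (\<Sum>j<?n. q ^ (Suc j choose 2) * of_int ((-1) ^ j * (2 * int j + 1)))"
  proof (rule sum.cong[OF refl])
    fix j assume "j \<in> {..<?n}"
    then have "?c (?n - j) = of_nat j * (-1) ^ j"
      by (simp add: of_nat_diff minus_one_power_iff)
    moreover have "?c (?n + Suc j) = of_nat (Suc j) * (-1) ^ j"
      by (simp add: power_add algebra_simps)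
    ultimately have "?c (?n + Suc j) + ?c (?n - j) = of_int ((-1) ^ j * (2 * int j + 1))"
      by (simp add: algebra_simps)
    then show "q ^ (Suc j choose 2) * (?c (?n + Suc j) + ?c (?n - j)) =
      q ^ (Suc j choose 2) * of_int ((-1) ^ j * (2 * int j + 1))" by (simp only:)
  qed
  finally show ?thesis by (simp only: power3_eq_cube mult.assoc)
qed simp

text \<open>The triple product at z = 1. Its factor i = 0 is 2, matching the two equal terms of each
  pair; the rest tends to D^2, where D is the product of the 1 + q^i, and f_1 D = f_2 when read in
  q.\<close>

lemma gauss_psi_cutoff:
  fixes q :: "int fps"
  assumes q: "q = fps_X ^ d" "d > 0"
  shows "fps_cutoff N (qpoch (q\<^sup>2) N ^ 2) =
    fps_cutoff N (qpoch q N * (\<Sum>j<2 * N. q ^ (Suc j choose 2)))"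
proof (cases "N = 0")
  case False
  let ?n = "2 * N"
  define D where "D = (\<lambda>n. \<Prod>i<n. 1 + q ^ Suc i)"
  obtain m where m: "?n = Suc m" using False by (cases ?n) auto
  have D: "fps_cutoff N (D k) = fps_cutoff N (D N)" if "N \<le> k" for k
    using fps_cutoff_prod_X_power[OF q(2) that, of "1 :: int"] by (simp add: D_def q(1) del: power_Suc)
  have "q \<noteq> 0" by (simp add: q)
  from finite_triple_product[OF this, where n = ?n and z = 1]
  have eq: "D ?n * (2 * D m) = (\<Sum>k\<le>2 * ?n. qbinom q (2 * ?n) k * q ^ triangle_exp ?n k * 1)"
    by (simp add: D_def add.commute[of _ 1] del: power_Suc) (simp add: m prod.lessThan_Suc_shift del: prod.lessThan_Suc power_Suc)
  have "fps_cutoff N (2 * (qpoch q N * (D N * D N))) = fps_cutoff N (2 * (qpoch q N * (D ?n * D m)))"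
    using False m by (intro fps_cutoff_mult_cong D[symmetric] refl) auto
  also have "2 * (qpoch q N * (D ?n * D m)) = qpoch q N * (D ?n * (2 * D m))"
    by (simp only: mult_ac)
  also have "fps_cutoff N \<dots> = fps_cutoff N (\<Sum>j<?n. q ^ (Suc j choose 2) * (1 + 1))"
    unfolding eq by (rule fps_cutoff_triple_sum[OF q refl])
  also have "(\<Sum>j<?n. q ^ (Suc j choose 2) * (1 + 1)) = 2 * (\<Sum>j<?n. q ^ (Suc j choose 2))"
    by (simp add: sum_distrib_left mult.commute)
  finally have "fps_cutoff N (qpoch q N * (D N * D N)) = fps_cutoff N (\<Sum>j<?n. q ^ (Suc j choose 2))"
    by (rule fps_cutoff_mult_left_cancel[rotated]) simp
  then have "fps_cutoff N (qpoch q N * (qpoch q N * (D N * D N))) =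
      fps_cutoff N (qpoch q N * (\<Sum>j<?n. q ^ (Suc j choose 2)))"
    by (intro fps_cutoff_mult_cong refl)
  moreover have "qpoch (q\<^sup>2) N = qpoch q N * D N"
    by (simp add: qpoch_def D_def prod.distrib[symmetric] algebra_simps power2_eq_square power_mult_distrib)
  ultimately show ?thesis by (simp only: power2_eq_square mult_ac)
qed simp


section \<open>Counting coloured partitions\<close>

definition weighted_msets :: "('b \<Rightarrow> nat) \<Rightarrow> 'b set \<Rightarrow> nat \<Rightarrow> 'b multiset set" where
  "weighted_msets w S n = {M. set_mset M \<subseteq> S \<and> sum_mset (image_mset w M) = n}"

text \<open>A multiset either avoids x or arises by adding one copy of x to a smaller one.\<close>

lemma weighted_msets_insert:
  assumes "x \<notin> S"
  shows "weighted_msets w (insert x S) n = weighted_msets w S n \<union>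
    (if w x \<le> n then add_mset x ` weighted_msets w (insert x S) (n - w x) else {})"
    (is "?L = ?R")
proof
  show "?L \<subseteq> ?R"
  proof
    fix M assume M: "M \<in> ?L"
    show "M \<in> ?R"
    proof (cases "x \<in># M")
      case True
      then obtain M' where "M = add_mset x M'" by (meson mset_add)
      with M show ?thesis by (auto simp: weighted_msets_def)
    qed (use M in \<open>auto simp: weighted_msets_def\<close>)
  qed
  show "?R \<subseteq> ?L" by (auto simp: weighted_msets_def split: if_splits)
qed

lemma finite_weighted_msets:
  assumes "finite S" "\<And>x. x \<in> S \<Longrightarrow> w x > 0"
  shows "finite (weighted_msets w S n)"
  using assms
proof (induction S arbitrary: n rule: finite_induct)
  case empty
  have "weighted_msets w {} n \<subseteq> {{#}}" by (auto simp: weighted_msets_def)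
  then show ?case by (rule finite_subset) simp
next
  case (insert x S)
  show ?case
  \<comment> \<open>A second induction is needed because removing one copy of x keeps the set of
    parts and only lowers n.\<close>
  proof (induction n rule: less_induct)
    case (less n)
    have "w x > 0" using insert.prems by simp
    then have "finite (weighted_msets w (insert x S) (n - w x))" if "w x \<le> n"
      using less that by simp
    then show ?case
      using insert.IH insert.prems by (subst weighted_msets_insert[OF insert.hyps(2)]) auto
  qed
qed

definition weighted_fps :: "('b \<Rightarrow> nat) \<Rightarrow> 'b set \<Rightarrow> int fps" where
  "weighted_fps w S = Abs_fps (\<lambda>n. int (card (weighted_msets w S n)))"

text \<open>The recursion for adding x, with its two cases disjoint, reads W' = W + W' X^(w x); this
  replaces the geometric series.\<close>

lemma weighted_fps_insert:
  assumes "finite S" "x \<notin> S" and pos: "\<And>y. y \<in> insert x S \<Longrightarrow> w y > 0"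
  shows "weighted_fps w (insert x S) * (1 - fps_X ^ w x) = weighted_fps w S"
proof -
  have "weighted_fps w (insert x S) = weighted_fps w S + weighted_fps w (insert x S) * fps_X ^ w x"
  proof (rule fps_ext)
    fix n
    define A B where "A = weighted_msets w S n" and "B = weighted_msets w (insert x S)"
    have fin: "finite A" "finite (B k)" for k
      using assms unfolding A_def B_def by (intro finite_weighted_msets; simp)+
    have B: "B n = A \<union> (if w x \<le> n then add_mset x ` B (n - w x) else {})"
      unfolding A_def B_def by (rule weighted_msets_insert[OF assms(2)])
    show "weighted_fps w (insert x S) $ n =
      (weighted_fps w S + weighted_fps w (insert x S) * fps_X ^ w x) $ n"
    proof (cases "w x \<le> n")
      case True
      have "x \<notin># M" if "M \<in> A" for M
        using that assms(2) unfolding A_def weighted_msets_def by blast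
      then have "A \<inter> add_mset x ` B (n - w x) = {}" by fastforce
      then have "card (B n) = card A + card (add_mset x ` B (n - w x))"
        using True fin unfolding B by (simp add: card_Un_disjoint)
      also have "card (add_mset x ` B (n - w x)) = card (B (n - w x))"
        by (rule card_image) (simp add: inj_on_def)
      finally show ?thesis
        using True by (simp add: weighted_fps_def fps_X_power_mult_right_nth A_def B_def)
    next
      case False
      then have "B n = A" unfolding B by simp
      with False show ?thesis
        by (simp add: weighted_fps_def fps_X_power_mult_right_nth A_def B_def)
    qed
  qed
  then show ?thesis by (simp add: algebra_simps)
qed

lemma weighted_fps_prod:
  assumes "finite S" "\<And>x. x \<in> S \<Longrightarrow> w x > 0"
  shows "weighted_fps w S * (\<Prod>x\<in>S. 1 - fps_X ^ w x) = 1"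
  using assms
proof (induction S rule: finite_induct)
  case empty
  have "weighted_msets w {} n = (if n = 0 then {{#}} else {})" for n
    by (auto simp: weighted_msets_def)
  then show ?case by (auto simp: weighted_fps_def fps_eq_iff)
next
  case (insert x S)
  have "weighted_fps w (insert x S) * (\<Prod>y\<in>insert x S. 1 - fps_X ^ w y) =
     (weighted_fps w (insert x S) * (1 - fps_X ^ w x)) * (\<Prod>y\<in>S. 1 - fps_X ^ w y)"
    using insert.hyps by (simp add: mult.assoc)
  also have "\<dots> = 1"
    using insert by (subst weighted_fps_insert) auto
  finally show ?case .
qed

lemma weighted_msets_cong:
  assumes "\<And>x. w x \<le> n \<Longrightarrow> x \<in> S \<longleftrightarrow> x \<in> T"
  shows "weighted_msets w S n = weighted_msets w T n"
proof -
  have "w x \<le> n" if "x \<in># M" "sum_mset (image_mset w M) = n" for x M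
    using that by (metis add_mset_remove_trivial_eq le_add1 image_mset_add_mset sum_mset.insert
        insert_DiffM)
  then show ?thesis using assms unfolding weighted_msets_def by blast
qed

text \<open>The bound m makes the set of parts finite; a partition of n has no part above n, so any
  m \<ge> n gives the same count.\<close>

definition coloured_parts :: "nat \<Rightarrow> nat \<Rightarrow> (nat \<times> nat) set" where
  "coloured_parts c m = (\<Union>k\<in>{1..m}. {k} \<times> (if odd k then {0} else {..<c}))"

lemma mem_coloured_parts:
  "x \<in> coloured_parts c m \<longleftrightarrow> 0 < fst x \<and> fst x \<le> m \<and>
    (odd (fst x) \<longrightarrow> snd x = 0) \<and> (even (fst x) \<longrightarrow> snd x < c)"
  by (cases x; cases "odd (fst x)") (simp_all add: coloured_parts_def Suc_le_eq conj_ac)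

lemma gen_cubic_partitions_conv_weighted:
  assumes "n \<le> m"
  shows "gen_cubic_partitions c n = weighted_msets fst (coloured_parts c m) n"
proof -
  have "gen_cubic_partitions c n =
    weighted_msets fst {x. 0 < fst x \<and> (odd (fst x) \<longrightarrow> snd x = 0) \<and> (even (fst x) \<longrightarrow> snd x < c)} n"
    by (auto simp: gen_cubic_partitions_def weighted_msets_def)
  also have "\<dots> = weighted_msets fst (coloured_parts c m) n"
    using assms by (intro weighted_msets_cong) (simp add: mem_coloured_parts)
  finally show ?thesis .
qed

text \<open>Raising m by one adds an odd and an even size. One of the c colours of the even size
  completes f_1, and the other c - 1 go to f_2.\<close>

lemma prod_coloured_parts:
  assumes "c > 0"
  shows "(\<Prod>x\<in>coloured_parts c (2 * m). 1 - fps_X ^ fst x :: int fps) =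
    qpoch fps_X (2 * m) * qpoch (fps_X\<^sup>2) m ^ (c - 1)"
proof -
  have "(\<Prod>x\<in>coloured_parts c m. 1 - fps_X ^ fst x :: int fps) =
      (\<Prod>k\<in>{1..m}. if odd k then 1 - fps_X ^ k else (1 - fps_X ^ k) ^ c)" for m
    unfolding coloured_parts_def by (subst prod.UNION_disjoint) (auto simp: prod.cartesian_product' intro!: prod.cong)
  then have "(\<Prod>x\<in>coloured_parts c (2 * m). 1 - fps_X ^ fst x :: int fps) =
      (\<Prod>k\<in>{1..2 * m}. if odd k then 1 - fps_X ^ k else (1 - fps_X ^ k) ^ c)" .
  also have "\<dots> = qpoch fps_X (2 * m) * qpoch (fps_X\<^sup>2) m ^ (c - 1)"
  proof (induction m)
    case (Suc m)
    have "(fps_X :: int fps) ^ Suc (Suc (2 * m)) = (fps_X\<^sup>2) ^ Suc m"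
      by (simp only: power_mult[symmetric]) simp
    then have "(1 - fps_X ^ Suc (Suc (2 * m)) :: int fps) ^ c =
       (1 - fps_X ^ Suc (Suc (2 * m))) * (1 - (fps_X\<^sup>2) ^ Suc m) ^ (c - 1)"
      using assms by (simp only: power_eq_if[of _ c]) simp
    then show ?case using Suc
      by (simp add: qpoch_Suc power_mult_distrib mult_ac del: power_Suc)
  qed simp
  finally show ?thesis .
qed

lemma a_generating_function:
  assumes "c > 0"
  shows "fps_cutoff N (Abs_fps (\<lambda>n. int (a c n)) * (qpoch fps_X N * qpoch (fps_X\<^sup>2) N ^ (c - 1))) =
    fps_cutoff N 1"
proof -
  let ?S = "coloured_parts c (2 * N)"
  have "fps_cutoff N (Abs_fps (\<lambda>n. int (a c n))) = fps_cutoff N (weighted_fps fst ?S)"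
    using gen_cubic_partitions_conv_weighted[of _ "2 * N"]
    by (simp add: fps_cutoff_eq_fps_cutoff_iff a_def weighted_fps_def)
  moreover have "fps_cutoff N (qpoch fps_X N :: int fps) = fps_cutoff N (qpoch fps_X (2 * N))"
    using fps_cutoff_qpoch[of 1 N "2 * N", where 'a = int] by simp
  ultimately have "fps_cutoff N (Abs_fps (\<lambda>n. int (a c n)) *
        (qpoch fps_X N * qpoch (fps_X\<^sup>2) N ^ (c - 1))) =
      fps_cutoff N (weighted_fps fst ?S * (qpoch fps_X (2 * N) * qpoch (fps_X\<^sup>2) N ^ (c - 1)))"
    by (intro fps_cutoff_mult_cong refl)
  also have "qpoch fps_X (2 * N) * qpoch (fps_X\<^sup>2) N ^ (c - 1) =
      (\<Prod>x\<in>?S. 1 - fps_X ^ fst x :: int fps)"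
    using assms by (rule prod_coloured_parts[symmetric])
  also have "weighted_fps fst ?S * \<dots> = 1"
    by (rule weighted_fps_prod) (auto simp: coloured_parts_def)
  finally show ?thesis .
qed


section \<open>The congruence\<close>

text \<open>The inner binomial coefficients are multiples of p, and oddness of p gives the last term
  its sign.\<close>

lemma prime_dvd_one_minus_power:
  fixes x :: "'a::comm_ring_1"
  assumes "prime p" "odd p"
  shows "of_nat p dvd (1 - x) ^ p - (1 - x ^ p)"
proof -
  have "p > 0" using assms(1) prime_gt_0_nat by blast
  then obtain r where r: "p = Suc r" by (cases p) auto
  define t where "t = (\<lambda>k. of_nat (p choose k) * (-x) ^ k)"
  have "(1 - x) ^ p = (\<Sum>k\<le>p. t k)"
    using binomial_ring[of "-x" 1 p] by (simp add: t_def)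
  also have "\<dots> = t 0 + (\<Sum>k<r. t (Suc k)) + t p"
    unfolding r sum.atMost_Suc_shift by (simp add: lessThan_Suc_atMost[symmetric])
  also have "t 0 = 1" by (simp add: t_def)
  also have "t p = - (x ^ p)" using assms(2) by (simp add: t_def)
  finally have "(1 - x) ^ p - (1 - x ^ p) = (\<Sum>k<r. t (Suc k))" by simp
  also have "of_nat p dvd \<dots>"
    unfolding t_def
  proof (intro dvd_sum dvd_mult2)
    fix k assume "k \<in> {..<r}"
    then have "p dvd (p choose Suc k)" using assms(1) r by (intro dvd_choose_prime) auto
    then show "(of_nat p :: 'a) dvd of_nat (p choose Suc k)" by (elim dvdE) simp
  qed
  finally show ?thesis .
qed

lemma prime_dvd_qpoch_power:
  fixes q :: "'a::comm_ring_1"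
  assumes "prime p" "odd p"
  shows "of_nat p dvd qpoch q n ^ p - qpoch (q ^ p) n"
proof (induction n)
  case (Suc n)
  have *: "(q ^ p) ^ Suc n = (q ^ Suc n) ^ p" by (simp only: power_mult[symmetric] mult.commute)
  have "qpoch q (Suc n) ^ p - qpoch (q ^ p) (Suc n) =
     (qpoch q n ^ p - qpoch (q ^ p) n) * (1 - q ^ Suc n) ^ p +
     qpoch (q ^ p) n * ((1 - q ^ Suc n) ^ p - (1 - (q ^ Suc n) ^ p))"
    unfolding qpoch_Suc power_mult_distrib * by (simp only: algebra_simps)
  then show ?case
    using Suc prime_dvd_one_minus_power[OF assms, of "q ^ Suc n"] by (simp del: power_Suc)
qed simp

lemma qpoch_X_power_nth_eq_0:
  assumes "p > 0" "p dvd d" "\<not> p dvd k"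
  shows "qpoch (fps_X ^ d :: 'a::comm_ring_1 fps) n $ k = 0"
  using assms(3)
proof (induction n arbitrary: k)
  case (Suc n)
  have "\<not> p dvd k - d * Suc n" if "d * Suc n \<le> k"
    using that Suc.prems assms(2) by (metis dvd_diffD dvd_mult2)
  then show ?case using Suc
    by (simp add: qpoch_Suc right_diff_distrib power_mult[symmetric] fps_X_power_mult_right_nth del: power_Suc)
qed (use assms in \<open>auto intro!: gr0I\<close>)

text \<open>Since B is a series in X^p with constant term 1, coefficient i of A B is that of A plus
  multiples of earlier coefficients of A in the same residue class. The bound N reflects that A B is
  controlled only up to truncation.\<close>

lemma dvd_coeffs_of_dvd_mult:
  fixes A B :: "int fps"
  assumes "p > 0" and B0: "B $ 0 = 1" and B: "\<And>k. \<not> p dvd k \<Longrightarrow> B $ k = 0"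
    and AB: "\<And>i. i < N \<Longrightarrow> i mod p = l \<Longrightarrow> int p dvd (A * B) $ i"
    and "i < N" "i mod p = l"
  shows "int p dvd A $ i"
  using assms(5,6)
proof (induction i rule: less_induct)
  case (less i)
  have "(A * B) $ i = (\<Sum>j<i. A $ j * B $ (i - j)) + A $ i"
    by (simp add: fps_mult_nth B0 atLeast0AtMost lessThan_Suc_atMost[symmetric])
  moreover have "int p dvd (\<Sum>j<i. A $ j * B $ (i - j))"
  proof (rule dvd_sum)
    fix j assume j: "j \<in> {..<i}"
    show "int p dvd A $ j * B $ (i - j)"
    proof (cases "p dvd i - j")
      case True
      then have "j mod p = i mod p"
        using j by (metis lessThan_iff less_imp_le mod_eq_dvd_iff_nat)
      then have "int p dvd A $ j" using less j by simp
      then show ?thesis by simp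
    qed (simp add: B)
  qed
  ultimately show ?case using AB[OF less.prems] by (simp add: dvd_add_right_iff)
qed

text \<open>Divisibility holds for each pair (j, k) separately: completing squares in the exponent
  forces p to divide 2 j + 1, which is the weight in Jacobi's series.\<close>

lemma theta_product_nth_dvd:
  assumes p: "prime p" "p mod 8 = 5 \<or> p mod 8 = 7" and i: "p dvd 8 * i + 3"
  shows "int p dvd ((\<Sum>j<m. (fps_X\<^sup>2) ^ (Suc j choose 2) * of_int ((-1) ^ j * (2 * int j + 1))) *
    (\<Sum>k<m. fps_X ^ (Suc k choose 2))) $ i"
proof -
  have tri: "8 * (Suc j choose 2) + 1 = (2 * j + 1)\<^sup>2" for j
    by (induction j) (simp_all add: numeral_2_eq_2 algebra_simps)
  have "int p dvd ((fps_X\<^sup>2) ^ (Suc j choose 2) * of_int ((-1) ^ j * (2 * int j + 1)) * fps_X ^ (Suc k choose 2)) $ i"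
    (is "_ dvd ?t $ i") for j k
  proof -
    let ?c = "(-1) ^ j * (2 * int j + 1)" and ?e = "2 * (Suc j choose 2) + (Suc k choose 2)"
    have "of_int ?c = (fps_const ?c :: int fps)" by (simp only: fps_of_int[symmetric] of_int_eq_id id_apply)
    then have "?t = fps_const ?c * fps_X ^ ?e"
      by (simp only: power_mult[symmetric] power_add mult_ac)
    then have t: "?t $ i = (if i = ?e then ?c else 0)" by simp
    show ?thesis
    proof (cases "i = ?e")
      case True
      have "2 * (2 * j + 1)\<^sup>2 + (2 * k + 1)\<^sup>2 = 8 * i + 3"
        unfolding tri[symmetric] True by simp
      with i have "p dvd 2 * (2 * j + 1)\<^sup>2 + (2 * k + 1)\<^sup>2" by (simp only:)
      then have "p dvd 2 * j + 1" by (rule prime_dvd_sum_square_twice_square[OF p])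
      then have "int p dvd 2 * int j + 1"
        using of_nat_dvd_iff[of p "2 * j + 1", where 'a = int] by (simp add: add.commute)
      then show ?thesis unfolding t by simp
    next
      case False
      then show ?thesis unfolding t by simp
    qed
  qed
  then show ?thesis
    unfolding sum_product fps_sum_nth by (intro dvd_sum)
qed

theorem theorem3p1:
  fixes p l n :: nat
  assumes "prime p"
    and "p mod 8 = 5 \<or> p mod 8 = 7"
    and "l \<le> p - 1"
    and "p dvd 8 * l + 3"
  shows "p dvd a (p - 4) (p * n + l)"
proof -
  have odd: "odd p" using assms(2) by presburger
  have "p \<ge> 5" using assms(2) mod_less_eq_dividend[of p 8] by auto
  \<comment> \<open>The successor keeps the coefficient at p n + l below the truncation.\<close>
  define N where "N = Suc (p * n + l)"
  define A where "A = Abs_fps (\<lambda>n. int (a (p - 4) n))"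
  define E where "E = (qpoch fps_X N :: int fps)"
  define E2 where "E2 = (qpoch (fps_X\<^sup>2) N :: int fps)"
  define B where "B = (qpoch ((fps_X\<^sup>2) ^ p) N :: int fps)"
  define J where "J = (\<Sum>j<2 * N. (fps_X\<^sup>2) ^ (Suc j choose 2) * of_int ((-1) ^ j * (2 * int j + 1)) :: int fps)"
  define \<psi> where "\<psi> = (\<Sum>k<2 * N. fps_X ^ (Suc k choose 2) :: int fps)"
  have J: "fps_cutoff N (E2 ^ 3) = fps_cutoff N J"
    unfolding E2_def J_def by (rule jacobi_cube_cutoff) auto
  have psi: "fps_cutoff N (E2 ^ 2) = fps_cutoff N (E * \<psi>)"
    unfolding E2_def E_def \<psi>_def by (rule gauss_psi_cutoff[of _ 1]) auto
  have "fps_cutoff N (A * (E * E2 ^ (p - 5))) = fps_cutoff N 1"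
    using a_generating_function[of "p - 4" N] \<open>p \<ge> 5\<close> by (simp add: A_def E_def E2_def)
  \<comment> \<open>The factor f_2^5 raises the exponent p - 5 to p on one side and splits as f_2^3
    f_2^2 on the other, ready for Jacobi and Gauss; f_1 then cancels.\<close>
  then have "fps_cutoff N (E2 ^ 5 * (A * (E * E2 ^ (p - 5)))) = fps_cutoff N (E2 ^ 5 * 1)"
    by (intro fps_cutoff_mult_cong refl)
  also have "E2 ^ 5 * 1 = E2 ^ 3 * E2 ^ 2" by (simp flip: power_add)
  also have "fps_cutoff N \<dots> = fps_cutoff N (J * (E * \<psi>))"
    by (intro fps_cutoff_mult_cong J psi)
  also have "E2 ^ 5 * (A * (E * E2 ^ (p - 5))) = E * (A * (E2 ^ 5 * E2 ^ (p - 5)))"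
    by (simp only: mult_ac)
  also have "E2 ^ 5 * E2 ^ (p - 5) = E2 ^ p" using \<open>p \<ge> 5\<close> by (simp flip: power_add)
  also have "J * (E * \<psi>) = E * (J * \<psi>)" by (simp only: mult_ac)
  finally have main: "fps_cutoff N (A * E2 ^ p) = fps_cutoff N (J * \<psi>)"
    by (rule fps_cutoff_mult_left_cancel[rotated])
      (use qpoch_X_power_nth_0[of 1 N, where 'a = int] in \<open>simp add: E_def\<close>)
  obtain H where "E2 ^ p - B = of_nat p * H"
    using prime_dvd_qpoch_power[OF assms(1) odd] unfolding E2_def B_def by blast
  then have H: "A * E2 ^ p = A * B + of_nat p * (A * H)" by (simp add: algebra_simps)
  have AB: "int p dvd (A * B) $ i" if "i < N" "i mod p = l" for i
  proof -
    have "i = p * (i div p) + l" using that(2) by (metis mult_div_mod_eq)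
    then have "8 * i + 3 = p * (8 * (i div p)) + (8 * l + 3)" by (simp add: algebra_simps)
    then have "p dvd 8 * i + 3" using assms(4) by (metis dvd_add dvd_triv_left)
    then have "int p dvd (J * \<psi>) $ i"
      unfolding J_def \<psi>_def by (rule theta_product_nth_dvd[OF assms(1,2)])
    also have "(J * \<psi>) $ i = (A * E2 ^ p) $ i"
      using main that(1) by (simp add: fps_cutoff_eq_fps_cutoff_iff)
    also have "\<dots> = (A * B) $ i + int p * (A * H) $ i"
      unfolding H by (simp add: fps_of_nat[symmetric] mult.assoc)
    finally show ?thesis by (simp add: dvd_add_left_iff)
  qed
  \<comment> \<open>The bound l \<le> p - 1 makes l the actual residue of p n + l modulo p.\<close>
  have "int p dvd A $ (p * n + l)"
  proof (rule dvd_coeffs_of_dvd_mult[OF _ _ _ AB])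
    show "B $ 0 = 1"
      unfolding B_def power_mult[symmetric] using \<open>p \<ge> 5\<close> by (intro qpoch_X_power_nth_0) simp
    show "B $ k = 0" if "\<not> p dvd k" for k
      unfolding B_def power_mult[symmetric] using \<open>p \<ge> 5\<close> that
      by (intro qpoch_X_power_nth_eq_0[of p]) auto
  qed (use \<open>p \<ge> 5\<close> assms(3) in \<open>auto simp: N_def\<close>)
  then show ?thesis by (simp add: A_def)
qed

end
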